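(* If a non-sequential $N$-DM system possesses Property C, then it possesses Property DF.
   Context: **Model.** A non-sequential system with $N\in\mathbb{N}$ decision makers (DMs) consists of: a probability space $(\Omega,\mathcal{F},P)$; standard Borel action spaces $(\mathbb{U}^i,\mathcal{U}^i)$ and standard Borel measurement spaces $(\mathbb{Y}^i,\mathcal{Y}^i)$, $i=1,\dots,N$; measurable measurement functions $\eta^i:\Omega\times\prod_{k=1}^N\mathbb{U}^k\to\mathbb{Y}^i$, giving the measurement $y^i=\eta^i(\omega,\mathbf{u})$ of DM $i$, where $\mathbf{u}=(u^1,\dots,u^N)$. An admissible policy is $\gamma=(\gamma^1,\dots,\gamma^N)\in\Gamma$ with each $\gamma^i:\mathbb{Y}^i\to\mathbb{U}^i$ measurable, $u^i=\gamma^i(y^i)$. **Orderings.** For $k=1,\dots,N$, $S_k$ is the set of $k$-DM orderings $(s_1,\dots,s_k)$ (sequences of $k$ distinct elements of $\{1,\dots,N\}$); $s_j=i$ means that DM $i$ is the $j$-th to act. $T^N_k:S_N\to S_k$ is truncation to the first $k$ entries. An ordering map is a map $\psi:\Omega\times\prod_i\mathbb{U}^i\to S_N$, $\psi(\omega,\mathbf{u})=(s_1,\dots,s_N)$. **Induced objects.** Given $\psi$, let $\bar y^k=\sum_i\eta^i(\omega,\mathbf{u})1_{\{s_k=i\}}$ (i.e. $\bar y^k=\eta^i(\omega,\mathbf{u})$ when $s_k=i$) and $\bar u^k=\sum_iu^i1_{\{s_k=i\}}$ (i.e. $\bar u^k=u^i$ when $s_k=i$), with values in $\bigcup_i\mathbb{Y}^i$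 and $\bigcup_i\mathbb{U}^i$, regarded as standard Borel spaces containing the $\mathbb{Y}^i$ (resp. $\mathbb{U}^i$) as measurable subspaces. $\bar{\mathscr{J}}^k$ is the smallest $\sigma$-algebra on $\Omega\times\prod_i\mathbb{U}^i$ making $\bar y^k$ measurable, and $\mathscr{F}^*(k)$ the smallest one making $(\omega,\bar u^1,\dots,\bar u^k)$ measurable ($\mathscr{F}^*(0)$: making $\omega$ measurable). **Property C (Causality).** There exists an ordering map $\psi$ such that for all $k\in\{1,\dots,N\}$ and $s\in S_k$, $\{E\cap[T^N_k\circ\psi]^{-1}(s)\mid E\in\bar{\mathscr{J}}^k\}\subseteq\mathscr{F}^*(k-1)$. **Property DF (Deadlock-freeness).** For each $\gamma\in\Gamma$ and every $\omega\in\Omega$ there exists an ordering $\gamma^{s_1(\omega)},\dots,\gamma^{s_N(\omega)}$ of the $N$ control laws such that no control action $u^{s_i(\omega)}$, $i=1,\dots,N$, depends on the control actions that follow. Explicitly: there are an ordering $(s_1,\dots,s_N)\in S_N$ and values $u_*^{s_1},\dots,u_*^{s_N}$ such that for each $i$, $\gamma^{s_i}(\eta^{s_i}(\omega,\mathbf{u}))=u_*^{s_i}$ for all $\mathbf{u}$ with $u^{s_j}=u_*^{s_j}$ for every $j<i$. *)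

theory Defs
  imports "HOL-Probability.Probability"
begin

definition standard_borel :: "'a measure \<Rightarrow> bool" where
  "standard_borel A \<longleftrightarrow>
     (\<exists>T. completely_metrizable_space T \<and> separable_space T \<and> topspace T = space A \<and>
          sets A = sigma_sets (space A) {V. openin T V})"

text \<open>
  Decision makers are numbered 1 to N. All action spaces U i live on one HOL type, as measurable
  subspaces of the standard Borel space UU, their union; the spaces need not be disjoint. The same
  holds for the measurement spaces Y i and YY. A profile of actions is an element of the extensional
  product over {1..N}. Only the sigma-algebras of U, UU, Y, YY matter, not their measures.

  Measurement spaces are assumed nonempty: otherwise U i = Y i = {} would be allowed, the empty
  function would be an admissible control law, and yet there would be no action for DM i to take.
  Action spaces need no such assumption: if one is empty, no policy is admissible.
\<close>

locale nonsequential_system =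
  prob_space M
  for M :: "'w measure"
  and N :: nat
  and UU :: "'u measure" and U :: "nat \<Rightarrow> 'u measure"
  and YY :: "'y measure" and Y :: "nat \<Rightarrow> 'y measure"
  and \<eta> :: "nat \<Rightarrow> 'w \<times> (nat \<Rightarrow> 'u) \<Rightarrow> 'y" +
  assumes UU_standard_borel: "standard_borel UU"
    and UU_space: "space UU = (\<Union>i\<in>{1..N}. space (U i))"
    and U_standard_borel: "\<And>i. i \<in> {1..N} \<Longrightarrow> standard_borel (U i)"
    and U_measurable: "\<And>i. i \<in> {1..N} \<Longrightarrow> space (U i) \<in> sets UU"
    and U_subspace: "\<And>i. i \<in> {1..N} \<Longrightarrow> sets (U i) = sets (restrict_space UU (space (U i)))"
    and YY_standard_borel: "standard_borel YY"
    and YY_space: "space YY = (\<Union>i\<in>{1..N}. space (Y i))"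
    and Y_standard_borel: "\<And>i. i \<in> {1..N} \<Longrightarrow> standard_borel (Y i)"
    and Y_measurable: "\<And>i. i \<in> {1..N} \<Longrightarrow> space (Y i) \<in> sets YY"
    and Y_subspace: "\<And>i. i \<in> {1..N} \<Longrightarrow> sets (Y i) = sets (restrict_space YY (space (Y i)))"
    and Y_nonempty: "\<And>i. i \<in> {1..N} \<Longrightarrow> space (Y i) \<noteq> {}"
    and \<eta>_measurable:
      "\<And>i. i \<in> {1..N} \<Longrightarrow> \<eta> i \<in> measurable (M \<Otimes>\<^sub>M PiM {1..N} U) (Y i)"

definition policies ::
  "nat \<Rightarrow> (nat \<Rightarrow> 'u measure) \<Rightarrow> (nat \<Rightarrow> 'y measure) \<Rightarrow> (nat \<Rightarrow> 'y \<Rightarrow> 'u) set" where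
  "policies N U Y = {\<gamma>. \<forall>i\<in>{1..N}. \<gamma> i \<in> measurable (Y i) (U i)}"

text \<open>
  An ordering is a list, so the k-th DM to act (counting from 1) is s ! (k - 1), and truncation
  to the first k entries is take k.
\<close>

definition orderings :: "nat \<Rightarrow> nat \<Rightarrow> nat list set" where
  "orderings N k = {s. length s = k \<and> distinct s \<and> set s \<subseteq> {1..N}}"

definition ybar ::
  "(nat \<Rightarrow> 'w \<times> (nat \<Rightarrow> 'u) \<Rightarrow> 'y) \<Rightarrow> ('w \<times> (nat \<Rightarrow> 'u) \<Rightarrow> nat list) \<Rightarrow>
   nat \<Rightarrow> 'w \<times> (nat \<Rightarrow> 'u) \<Rightarrow> 'y" where
  "ybar \<eta> \<psi> k x = \<eta> (\<psi> x ! (k - 1)) x"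

definition ubar ::
  "('w \<times> (nat \<Rightarrow> 'u) \<Rightarrow> nat list) \<Rightarrow> nat \<Rightarrow> 'w \<times> (nat \<Rightarrow> 'u) \<Rightarrow> 'u" where
  "ubar \<psi> k x = snd x (\<psi> x ! (k - 1))"

definition Jbar ::
  "'w measure \<Rightarrow> nat \<Rightarrow> (nat \<Rightarrow> 'u measure) \<Rightarrow> 'y measure \<Rightarrow>
   (nat \<Rightarrow> 'w \<times> (nat \<Rightarrow> 'u) \<Rightarrow> 'y) \<Rightarrow> ('w \<times> (nat \<Rightarrow> 'u) \<Rightarrow> nat list) \<Rightarrow>
   nat \<Rightarrow> ('w \<times> (nat \<Rightarrow> 'u)) measure" where
  "Jbar M N U YY \<eta> \<psi> k =
     vimage_algebra (space (M \<Otimes>\<^sub>M PiM {1..N} U)) (ybar \<eta> \<psi> k) YY"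

text \<open>For k = 0 the product over {1..k} is a one-point space, leaving what makes \<omega> measurable.\<close>

definition Fstar ::
  "'w measure \<Rightarrow> nat \<Rightarrow> 'u measure \<Rightarrow> (nat \<Rightarrow> 'u measure) \<Rightarrow>
   ('w \<times> (nat \<Rightarrow> 'u) \<Rightarrow> nat list) \<Rightarrow> nat \<Rightarrow> ('w \<times> (nat \<Rightarrow> 'u)) measure" where
  "Fstar M N UU U \<psi> k =
     vimage_algebra (space (M \<Otimes>\<^sub>M PiM {1..N} U))
       (\<lambda>x. (fst x, \<lambda>j\<in>{1..k}. ubar \<psi> j x))
       (M \<Otimes>\<^sub>M PiM {1..k} (\<lambda>_. UU))"

definition property_C ::
  "'w measure \<Rightarrow> nat \<Rightarrow> 'u measure \<Rightarrow> (nat \<Rightarrow> 'u measure) \<Rightarrow> 'y measure \<Rightarrow>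
   (nat \<Rightarrow> 'w \<times> (nat \<Rightarrow> 'u) \<Rightarrow> 'y) \<Rightarrow> bool" where
  "property_C M N UU U YY \<eta> \<longleftrightarrow>
     (\<exists>\<psi> \<in> space (M \<Otimes>\<^sub>M PiM {1..N} U) \<rightarrow> orderings N N.
        \<forall>k\<in>{1..N}. \<forall>s\<in>orderings N k.
          {E \<inter> {x \<in> space (M \<Otimes>\<^sub>M PiM {1..N} U). take k (\<psi> x) = s} | E.
             E \<in> sets (Jbar M N U YY \<eta> \<psi> k)}
          \<subseteq> sets (Fstar M N UU U \<psi> (k - 1)))"

text \<open>The values ustar i are indexed by the DM i, not by its position in the ordering.\<close>

definition property_DF ::
  "'w measure \<Rightarrow> nat \<Rightarrow> (nat \<Rightarrow> 'u measure) \<Rightarrow> (nat \<Rightarrow> 'y measure) \<Rightarrow>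
   (nat \<Rightarrow> 'w \<times> (nat \<Rightarrow> 'u) \<Rightarrow> 'y) \<Rightarrow> bool" where
  "property_DF M N U Y \<eta> \<longleftrightarrow>
     (\<forall>\<gamma>\<in>policies N U Y. \<forall>\<omega>\<in>space M.
        \<exists>s\<in>orderings N N. \<exists>ustar\<in>space (PiM {1..N} U).
          \<forall>i\<in>{1..N}. \<forall>u\<in>space (PiM {1..N} U).
            (\<forall>j\<in>{1..<i}. u (s ! (j - 1)) = ustar (s ! (j - 1))) \<longrightarrow>
            \<gamma> (s ! (i - 1)) (\<eta> (s ! (i - 1)) (\<omega>, u)) = ustar (s ! (i - 1)))"

end

theory Submission
  imports Defs
begin

text \<open>
  A set in the sigma-algebra generated by a map f cannot separate two points with the same value
  of f. Hence, under Property C, the actions of the first k - 1 decision makers (together with \<omega>) determine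
  the first k entries of the ordering and the k-th measurement. Starting from an arbitrary action
  profile and correcting the actions one by one, in the order prescribed by \<psi> at the current
  profile, therefore never disturbs a correction already made, and ends at a profile consistent
  with the policy; the ordering at this profile is deadlock-free.
\<close>

text \<open>The sets containing both or neither of two given points of \<open>X\<close> form a
  sigma-algebra on \<open>X\<close>; it contains every preimage under \<open>f\<close> as soon as
  \<open>f\<close> agrees at the two points.\<close>

lemma vimage_algebra_not_separating:
  assumes "A \<in> sets (vimage_algebra X f M)" "x \<in> X" "y \<in> X" "f x = f y"
  shows "x \<in> A \<longleftrightarrow> y \<in> A"
proof -
  have "A \<in> sigma_sets X {f -` B \<inter> X | B. B \<in> sets M}"
    using assms(1) by (simp add: sets_vimage_algebra)
  then show ?thesis
    by induction (use assms(2-4) in auto)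
qed

text \<open>Metrizable spaces are T1, so points are closed and hence Borel. This makes the fibres of
  \<open>ybar\<close> sets of \<open>Jbar\<close>.\<close>

lemma standard_borel_singleton:
  assumes "standard_borel A" "y \<in> space A"
  shows "{y} \<in> sets A"
proof -
  obtain T where T: "completely_metrizable_space T" "topspace T = space A"
    "sets A = sigma_sets (space A) {V. openin T V}"
    using assms(1) unfolding standard_borel_def by blast
  have "t1_space T"
    using T(1) by (simp add: completely_metrizable_imp_metrizable_space
        metrizable_imp_t1_space)
  then have "closedin T {y}"
    using assms(2) T(2) by (simp add: t1_space_closedin_singleton)
  then have "openin T (space A - {y})"
    using T(2) by (metis closedin_def)
  then have "space A - {y} \<in> sets A"
    unfolding T(3) by (intro sigma_sets.Basic) simp
  then have "space A - (space A - {y}) \<in> sets A"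
    by (rule sets.compl_sets)
  with assms(2) show ?thesis
    by (simp add: Diff_Diff_Int)
qed

text \<open>The body of \<open>property_C\<close> without the quantifier over \<open>\<psi>\<close>,
  so that one witness can be fixed throughout.\<close>

definition causal_ordering ::
  "'w measure \<Rightarrow> nat \<Rightarrow> 'u measure \<Rightarrow> (nat \<Rightarrow> 'u measure) \<Rightarrow> 'y measure \<Rightarrow>
   (nat \<Rightarrow> 'w \<times> (nat \<Rightarrow> 'u) \<Rightarrow> 'y) \<Rightarrow> ('w \<times> (nat \<Rightarrow> 'u) \<Rightarrow> nat list) \<Rightarrow> bool" where
  "causal_ordering M N UU U YY \<eta> \<psi> \<longleftrightarrow>
     \<psi> \<in> space (M \<Otimes>\<^sub>M PiM {1..N} U) \<rightarrow> orderings N N \<and>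
     (\<forall>k\<in>{1..N}. \<forall>s\<in>orderings N k.
        {E \<inter> {x \<in> space (M \<Otimes>\<^sub>M PiM {1..N} U). take k (\<psi> x) = s} | E.
           E \<in> sets (Jbar M N U YY \<eta> \<psi> k)}
        \<subseteq> sets (Fstar M N UU U \<psi> (k - 1)))"

lemma property_C_iff_causal_ordering:
  "property_C M N UU U YY \<eta> \<longleftrightarrow> (\<exists>\<psi>. causal_ordering M N UU U YY \<eta> \<psi>)"
  unfolding property_C_def causal_ordering_def by blast

lemma take_in_orderings:
  assumes "s \<in> orderings N N" "k \<le> N"
  shows "take k s \<in> orderings N k"
  using assms set_take_subset[of k s] by (auto simp: orderings_def)

lemma orderings_nth:
  assumes "s \<in> orderings N N" "k < N"
  shows "s ! k \<in> {1..N}"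
  using assms nth_mem[of k s] by (auto simp: orderings_def simp del: nth_mem)

context nonsequential_system
begin

lemma \<eta>_in_YY:
  assumes "i \<in> {1..N}" "x \<in> space (M \<Otimes>\<^sub>M PiM {1..N} U)"
  shows "\<eta> i x \<in> space YY"
  using assms measurable_space[OF \<eta>_measurable] unfolding YY_space by blast

text \<open>Both conclusions come from one set: the fibre of \<open>ybar\<close> through
  \<open>x\<close>, cut down to the points whose ordering begins like that of \<open>x\<close>. It
  lies in \<open>Fstar\<close> by Property C, so it cannot separate \<open>x\<close> from
  \<open>y\<close>.\<close>

lemma causal_ordering_determined_by_ubar:
  assumes causal: "causal_ordering M N UU U YY \<eta> \<psi>"
    and k: "k \<in> {1..N}"
    and x: "x \<in> space (M \<Otimes>\<^sub>M PiM {1..N} U)" and y: "y \<in> space (M \<Otimes>\<^sub>M PiM {1..N} U)"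
    and "fst x = fst y" and "\<And>j. j \<in> {1..k - 1} \<Longrightarrow> ubar \<psi> j x = ubar \<psi> j y"
  shows "take k (\<psi> y) = take k (\<psi> x) \<and> ybar \<eta> \<psi> k y = ybar \<eta> \<psi> k x"
proof -
  define X where "X = space (M \<Otimes>\<^sub>M PiM {1..N} U)"
  define E where "E = ybar \<eta> \<psi> k -` {ybar \<eta> \<psi> k x} \<inter> X"
  have s: "\<psi> x \<in> orderings N N"
    using causal x unfolding causal_ordering_def by blast
  have "ybar \<eta> \<psi> k x \<in> space YY"
    unfolding ybar_def using orderings_nth[OF s, of "k - 1"] k x by (intro \<eta>_in_YY) auto
  then have "E \<in> sets (Jbar M N U YY \<eta> \<psi> k)"
    unfolding E_def X_def Jbar_def
    by (intro in_vimage_algebra standard_borel_singleton YY_standard_borel)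
  moreover have "take k (\<psi> x) \<in> orderings N k"
    using take_in_orderings[OF s] k by simp
  ultimately have "E \<inter> {z \<in> X. take k (\<psi> z) = take k (\<psi> x)} \<in> sets (Fstar M N UU U \<psi> (k - 1))"
    using causal k unfolding causal_ordering_def X_def by blast
  from vimage_algebra_not_separating[OF this[unfolded Fstar_def] x y] assms(5,6)
  have "x \<in> E \<inter> {z \<in> X. take k (\<psi> z) = take k (\<psi> x)} \<longleftrightarrow>
      y \<in> E \<inter> {z \<in> X. take k (\<psi> z) = take k (\<psi> x)}"
    by (simp cong: restrict_cong)
  with x show ?thesis
    by (auto simp: E_def X_def)
qed

text \<open>Each \<open>ubar\<close> reads the actions through the ordering at its own profile, so
  agreement of \<open>u\<close> and \<open>v\<close> along the ordering at \<open>(w, u)\<close> is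
  not yet agreement of the \<open>ubar\<close>. Strong induction closes this gap: the smaller
  indices show that both orderings have the same first \<open>k\<close> entries. Here
  \<open>k\<close> counts from 0, hence the shift to \<open>Suc k\<close>.\<close>

lemma causal_ordering_determined_by_past:
  assumes causal: "causal_ordering M N UU U YY \<eta> \<psi>"
    and w: "w \<in> space M"
    and u: "u \<in> space (PiM {1..N} U)" and v: "v \<in> space (PiM {1..N} U)"
    and "k < N"
    and "\<And>j. j < k \<Longrightarrow> v (\<psi> (w, u) ! j) = u (\<psi> (w, u) ! j)"
  shows "take (Suc k) (\<psi> (w, v)) = take (Suc k) (\<psi> (w, u)) \<and>
    \<eta> (\<psi> (w, u) ! k) (w, v) = \<eta> (\<psi> (w, u) ! k) (w, u)"
  using assms(5,6)
proof (induction k rule: less_induct)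
  case (less k)
  have *: "(w, u) \<in> space (M \<Otimes>\<^sub>M PiM {1..N} U)" "(w, v) \<in> space (M \<Otimes>\<^sub>M PiM {1..N} U)"
    using w u v by (auto simp: space_pair_measure)
  have nth: "\<psi> (w, v) ! j = \<psi> (w, u) ! j" if "j < k" for j
  proof -
    have "take (Suc j) (\<psi> (w, v)) = take (Suc j) (\<psi> (w, u))"
      using less that by simp
    then show ?thesis
      by (metis lessI nth_take)
  qed
  have "ubar \<psi> j (w, u) = ubar \<psi> j (w, v)" if "j \<in> {1..Suc k - 1}" for j
  proof -
    have "j - 1 < k"
      using that by auto
    then show ?thesis
      using nth[of "j - 1"] less.prems(2)[of "j - 1"] by (simp add: ubar_def)
  qed
  then have "take (Suc k) (\<psi> (w, v)) = take (Suc k) (\<psi> (w, u))"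
    and "ybar \<eta> \<psi> (Suc k) (w, v) = ybar \<eta> \<psi> (Suc k) (w, u)"
    using causal_ordering_determined_by_ubar[OF causal, of "Suc k", OF _ *] less.prems(1) by auto
  moreover from this have "\<psi> (w, v) ! k = \<psi> (w, u) ! k"
    by (metis lessI nth_take)
  ultimately show ?case
    by (simp add: ybar_def)
qed

text \<open>A control law maps the nonempty \<open>Y i\<close> into \<open>U i\<close>, so no action
  space is empty. This supplies the initial profile for the corrections.\<close>

lemma action_profile_exists:
  assumes "\<gamma> \<in> policies N U Y"
  shows "\<exists>u. u \<in> space (PiM {1..N} U)"
proof -
  have "space (U i) \<noteq> {}" if "i \<in> {1..N}" for i
    using assms that Y_nonempty[OF that] measurable_space[of "\<gamma> i" "Y i" "U i"]
    unfolding policies_def by blast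
  then show ?thesis
    by (auto simp: space_PiM PiE_eq_empty_iff ex_in_conv)
qed

lemma causal_ordering_partial_solution:
  assumes causal: "causal_ordering M N UU U YY \<eta> \<psi>"
    and \<gamma>: "\<gamma> \<in> policies N U Y" and w: "w \<in> space M" and "k \<le> N"
  shows "\<exists>u\<in>space (PiM {1..N} U). \<forall>j<k.
    \<gamma> (\<psi> (w, u) ! j) (\<eta> (\<psi> (w, u) ! j) (w, u)) = u (\<psi> (w, u) ! j)"
  using \<open>k \<le> N\<close>
proof (induction k)
  case 0
  then show ?case
    using action_profile_exists[OF \<gamma>] by auto
next
  case (Suc k)
  then obtain u where u: "u \<in> space (PiM {1..N} U)"
    and sol: "\<And>j. j < k \<Longrightarrow>
      \<gamma> (\<psi> (w, u) ! j) (\<eta> (\<psi> (w, u) ! j) (w, u)) = u (\<psi> (w, u) ! j)"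
    by auto
  define s where "s = \<psi> (w, u)"
  \<comment> \<open>The new action is computed from the measurement at \<open>u\<close>, yet it is
    also the one prescribed at \<open>v\<close>, because \<open>det\<close> shows that DM
    \<open>s ! k\<close> measures the same at both.\<close>
  define v where "v = u(s ! k := \<gamma> (s ! k) (\<eta> (s ! k) (w, u)))"
  have wu: "(w, u) \<in> space (M \<Otimes>\<^sub>M PiM {1..N} U)"
    using w u by (simp add: space_pair_measure)
  then have s: "s \<in> orderings N N"
    using causal unfolding causal_ordering_def s_def by blast
  have sk: "s ! k \<in> {1..N}"
    using orderings_nth[OF s] Suc.prems by simp
  then have "\<gamma> (s ! k) \<in> measurable (Y (s ! k)) (U (s ! k))"
    using \<gamma> unfolding policies_def by blast
  then have "\<gamma> (s ! k) (\<eta> (s ! k) (w, u)) \<in> space (U (s ! k))"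
    using measurable_space[OF \<eta>_measurable[OF sk] wu] by (rule measurable_space)
  with u sk have v: "v \<in> space (PiM {1..N} U)"
    unfolding v_def space_PiM by (auto simp: PiE_iff extensional_def)
  \<comment> \<open>The entries of \<open>s\<close> are distinct, so changing the action of
    \<open>s ! k\<close> touches no earlier DM.\<close>
  have same: "v (s ! j) = u (s ! j)" if "j < k" for j
    using s that Suc.prems by (auto simp: v_def orderings_def nth_eq_iff_index_eq)
  \<comment> \<open>The case \<open>j = k\<close> is included although \<open>u\<close> and
    \<open>v\<close> may differ at \<open>s ! k\<close>: only agreement strictly before position
    \<open>j\<close> is required.\<close>
  have det: "take (Suc j) (\<psi> (w, v)) = take (Suc j) s"
    "\<eta> (s ! j) (w, v) = \<eta> (s ! j) (w, u)" if "j < Suc k" for j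
    using causal_ordering_determined_by_past[OF causal w u v, of j] same that Suc.prems
    by (auto simp: s_def)
  have "\<gamma> (\<psi> (w, v) ! j) (\<eta> (\<psi> (w, v) ! j) (w, v)) = v (\<psi> (w, v) ! j)" if j: "j < Suc k" for j
  proof -
    have "\<psi> (w, v) ! j = s ! j"
      using det(1)[OF j] by (metis lessI nth_take)
    moreover have "\<gamma> (s ! j) (\<eta> (s ! j) (w, u)) = v (s ! j)"
    proof (cases "j = k")
      case True
      then show ?thesis by (simp add: v_def)
    next
      case False
      with j have "j < k" by simp
      then show ?thesis using sol same by (simp add: s_def)
    qed
    ultimately show ?thesis
      using det(2)[OF j] by simp
  qed
  with v show ?case by blast
qed

end

theorem proposition2p4:
  fixes M :: "'w measure"
    and N :: nat
    and UU :: "'u measure" and U :: "nat \<Rightarrow> 'u measure"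
    and YY :: "'y measure" and Y :: "nat \<Rightarrow> 'y measure"
    and \<eta> :: "nat \<Rightarrow> 'w \<times> (nat \<Rightarrow> 'u) \<Rightarrow> 'y"
  assumes "nonsequential_system M N UU U YY Y \<eta>"
    and "property_C M N UU U YY \<eta>"
  shows "property_DF M N U Y \<eta>"
  unfolding property_DF_def
proof (intro ballI)
  interpret nonsequential_system M N UU U YY Y \<eta> by fact
  fix \<gamma> w assume \<gamma>: "\<gamma> \<in> policies N U Y" and w: "w \<in> space M"
  obtain \<psi> where causal: "causal_ordering M N UU U YY \<eta> \<psi>"
    using assms(2) property_C_iff_causal_ordering by blast
  \<comment> \<open>With all \<open>N\<close> actions settled, \<open>u\<close> itself serves as
    \<open>ustar\<close>, and the ordering at \<open>(w, u)\<close> as \<open>s\<close>.\<close>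
  obtain u where u: "u \<in> space (PiM {1..N} U)"
    and sol: "\<And>j. j < N \<Longrightarrow>
      \<gamma> (\<psi> (w, u) ! j) (\<eta> (\<psi> (w, u) ! j) (w, u)) = u (\<psi> (w, u) ! j)"
    using causal_ordering_partial_solution[OF causal \<gamma> w order_refl] by blast
  have "(w, u) \<in> space (M \<Otimes>\<^sub>M PiM {1..N} U)"
    using w u by (simp add: space_pair_measure)
  then have "\<psi> (w, u) \<in> orderings N N"
    using causal unfolding causal_ordering_def by blast
  moreover have "\<gamma> (\<psi> (w, u) ! (i - 1)) (\<eta> (\<psi> (w, u) ! (i - 1)) (w, v)) = u (\<psi> (w, u) ! (i - 1))"
    if i: "i \<in> {1..N}" and v: "v \<in> space (PiM {1..N} U)"
      and agree: "\<forall>j\<in>{1..<i}. v (\<psi> (w, u) ! (j - 1)) = u (\<psi> (w, u) ! (j - 1))" for i v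
  proof -
    \<comment> \<open>Property DF counts positions from 1, the lemmas on \<open>\<psi>\<close> from
      0; \<open>Suc j\<close> translates between them.\<close>
    have "v (\<psi> (w, u) ! j) = u (\<psi> (w, u) ! j)" if "j < i - 1" for j
      using bspec[OF agree, of "Suc j"] that by simp
    moreover have "i - 1 < N"
      using i by auto
    ultimately show ?thesis
      using causal_ordering_determined_by_past[OF causal w u v, of "i - 1"] sol[of "i - 1"]
      by simp
  qed
  ultimately show "\<exists>s\<in>orderings N N. \<exists>ustar\<in>space (PiM {1..N} U).
      \<forall>i\<in>{1..N}. \<forall>u\<in>space (PiM {1..N} U).
        (\<forall>j\<in>{1..<i}. u (s ! (j - 1)) = ustar (s ! (j - 1))) \<longrightarrow>
        \<gamma> (s ! (i - 1)) (\<eta> (s ! (i - 1)) (w, u)) = ustar (s ! (i - 1))"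
    using u by blast
qed

end
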